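(* Let $m\ge 2$ be an even integer and let $V=\{2s_1,\dots,2s_{\ell}\}$ with $\ell\ge 1$ and integers $1\le s_1<\cdots<s_{\ell}\le \frac{m}{2}$. Put $t_j=s_{j+1}-s_j$ for $1\le j\le \ell-1$ and $t_{\ell}=\frac{m}{2}-s_{\ell}+s_1$. For a positive integer $j$ let $\overline{j}\in\{1,\dots,\ell\}$ denote the element with $\overline{j}\equiv j\pmod{\ell}$. Then the sequence $H(D^{(m,V)})$ of Hankel determinants can be partitioned into consecutive sections of the form \[ H(D^{(m,V)})=(\underbrace{1,\dots,1}_{s_1},\underbrace{a_{1,1},\dots,a_{1,t_1}}_{t_1},\dots,\underbrace{a_{\ell,1},\dots,a_{\ell,t_{\ell}}}_{t_{\ell}},\underbrace{a_{\ell+1,1},\dots,a_{\ell+1,t_1}}_{t_1},\dots,\underbrace{a_{2\ell,1},\dots,a_{2\ell,t_{\ell}}}_{t_{\ell}},\dots) \] (the $j$-th section, $j\ge 1$, having length $t_{\overline{j}}$), such that each section $(a_{j,1},\dots,a_{j,t_{\overline{j}}})$ is an arithmetic progression with common difference $d_j$, where $a_{1,1}=0$, $d_1=-1$, and for $j\ge 2$: $a_{j,1}=d_{j-1}$ and $d_j=d_{j-1}-a_{j-1,t_{\overline{j-1}}}$.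
   Context: For an integer $m\ge 2$ and $V\subseteq[m]=\{1,\dots,m\}$, let $(m,V)=\{k\in\mathbb{Z}^+ : k\equiv j \pmod m \text{ for some } j\in V\}$. A Dyck path of size $n$ is a lattice path from $(0,0)$ to $(2n,0)$ with steps $(1,1)$ and $(1,-1)$ never going below the $x$-axis; a peak is an up-step immediately followed by a down-step, and its height is the $y$-coordinate of the point between them. Let $d_n^{(m,V)}$ be the number of Dyck paths of size $n$ none of whose peaks has height in $(m,V)$ (so $d_0^{(m,V)}=1$), and $D^{(m,V)}(x)=\sum_{n\ge0}d_n^{(m,V)}x^n$. For a power series $F=\sum_{n\ge0}f_nx^n$, $n\ge1$ and $k\ge0$, $H^{(k)}_n(F)=\det(f_{k+i+j})_{0\le i,j\le n-1}$, $H_n(F)=H^{(0)}_n(F)$, and $H(F)=(H_1(F),H_2(F),H_3(F),\dots)$. *)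

theory Defs
  imports
    "Jordan_Normal_Form.Determinant"
    "HOL-Computational_Algebra.Formal_Power_Series"
    "HOL-Number_Theory.Cong"
begin

(* (m,V), as a set of integers because heights of lattice paths are integers *)
definition residue_heights :: "nat \<Rightarrow> nat set \<Rightarrow> int set" where
  "residue_heights m V = {k. k > 0 \<and> (\<exists>j\<in>V. [k = int j] (mod int m))}"

(* the steps (1,1) and (1,-1) *)
datatype step = Up | Down

fun rise :: "step \<Rightarrow> int" where
  "rise Up = 1"
| "rise Down = - 1"

(* The lattice path of p starts at (0,0); after its first i steps it is at (i, height p i). *)
definition height :: "step list \<Rightarrow> nat \<Rightarrow> int" where
  "height p i = sum_list (map rise (take i p))"

definition dyck_path :: "nat \<Rightarrow> step list \<Rightarrow> bool" where
  "dyck_path n p \<longleftrightarrow>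
     length p = 2 * n \<and> height p (2 * n) = 0 \<and> (\<forall>i\<le>2 * n. height p i \<ge> 0)"

definition peak_heights :: "step list \<Rightarrow> int set" where
  "peak_heights p =
     {height p (Suc i) | i. Suc i < length p \<and> p ! i = Up \<and> p ! Suc i = Down}"

definition dyck_num :: "nat \<Rightarrow> nat set \<Rightarrow> nat \<Rightarrow> nat" where
  "dyck_num m V n = card {p. dyck_path n p \<and> peak_heights p \<inter> residue_heights m V = {}}"

definition dyck_gf :: "nat \<Rightarrow> nat set \<Rightarrow> int fps" where
  "dyck_gf m V = Abs_fps (\<lambda>n. int (dyck_num m V n))"

definition shifted_hankel_det :: "nat \<Rightarrow> nat \<Rightarrow> 'a :: comm_ring_1 fps \<Rightarrow> 'a" where
  "shifted_hankel_det k n F = det (mat n n (\<lambda>(i, j). fps_nth F (k + i + j)))"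

(* The n-th entry of H(F); the sequence is indexed from n = 1. *)
definition hankel_det :: "nat \<Rightarrow> 'a :: comm_ring_1 fps \<Rightarrow> 'a" where
  "hankel_det n F = shifted_hankel_det 0 n F"

end

(* Viewing a path at odd times, D(x) = 1 + x J(x) where J is the moment series of the tridiagonal
   matrix with off-diagonal entries 1 and diagonal entries b_i = 2 - [2(i+1) is forbidden]; the
   sign comes from excluding one of the two ways to stay at height 2i+1. Orthogonality then makes
   all but one column of the Hankel matrix trivial, giving H_{n+2} = b_n H_{n+1} - H_n with
   H_0 = H_1 = 1, in which b_n = 2 continues an arithmetic progression. *)
theory Submission
  imports Defs
begin

section \<open>Hankel determinants from a three-term recurrence\<close>

text \<open>Weighted count of Motzkin paths from height 0 to height \<open>k\<close> in
  \<open>n\<close> steps, a level step at height \<open>i\<close> having weight \<open>b i\<close>;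
  equivalently, entry \<open>(0, k)\<close> of the \<open>n\<close>-th power of a tridiagonal
  matrix.\<close>

fun motzkin_sum :: "(nat \<Rightarrow> 'a :: comm_ring_1) \<Rightarrow> nat \<Rightarrow> nat \<Rightarrow> 'a" where
  "motzkin_sum b 0 k = (if k = 0 then 1 else 0)"
| "motzkin_sum b (Suc n) k =
     (if k = 0 then 0 else motzkin_sum b n (k - 1)) + b k * motzkin_sum b n k
       + motzkin_sum b n (Suc k)"

text \<open>Up to alternating sign, a solution of the orthogonal polynomial recurrence evaluated at
  0. The initial values are the Hankel determinants of orders 0 and 1 of a series with constant term
  1.\<close>

fun three_term :: "(nat \<Rightarrow> 'a :: comm_ring_1) \<Rightarrow> nat \<Rightarrow> 'a" where
  "three_term b 0 = 1"
| "three_term b (Suc 0) = 1"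
| "three_term b (Suc (Suc n)) = b n * three_term b (Suc n) - three_term b n"

lemma motzkin_sum_eq_0: "n < k \<Longrightarrow> motzkin_sum b n k = 0"
  by (induction n arbitrary: k) auto

lemma motzkin_sum_diag: "motzkin_sum b n n = 1"
  by (induction n) (auto simp: motzkin_sum_eq_0)

text \<open>The tridiagonal operator is symmetric, so one step can be moved from the path sum to the
  vector \<open>v\<close>. The bound on \<open>N\<close> puts the cut-off beyond the support, so the
  boundary terms vanish.\<close>

lemma motzkin_sum_adjoint:
  assumes "Suc n < N"
  shows "(\<Sum>k<N. motzkin_sum b (Suc n) k * v k) =
    (\<Sum>k<N. motzkin_sum b n k * ((if k = 0 then 0 else v (k - 1)) + b k * v k + v (Suc k)))"
proof -
  obtain M where N: "N = Suc M" and "n < M"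
    using assms by (cases N) auto
  then have zero: "motzkin_sum b n M = 0" "motzkin_sum b n (Suc M) = 0"
    by (auto simp: motzkin_sum_eq_0)
  have down: "(\<Sum>k<N. (if k = 0 then 0 else motzkin_sum b n (k - 1)) * v k)
      = (\<Sum>k<N. motzkin_sum b n k * v (Suc k))"
    unfolding N by (subst sum.lessThan_Suc_shift) (simp add: zero)
  have up: "(\<Sum>k<N. motzkin_sum b n (Suc k) * v k)
      = (\<Sum>k<N. motzkin_sum b n k * (if k = 0 then 0 else v (k - 1)))"
  proof -
    have "(\<Sum>k<N. motzkin_sum b n k * (if k = 0 then 0 else v (k - 1)))
        = (\<Sum>k<M. motzkin_sum b n (Suc k) * v k)"
      unfolding N sum.lessThan_Suc_shift by simp
    then show ?thesis
      by (simp add: N zero)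
  qed
  have "(\<Sum>k<N. motzkin_sum b (Suc n) k * v k) =
      (\<Sum>k<N. (if k = 0 then 0 else motzkin_sum b n (k - 1)) * v k)
      + (\<Sum>k<N. motzkin_sum b n k * (b k * v k)) + (\<Sum>k<N. motzkin_sum b n (Suc k) * v k)"
    by (simp add: algebra_simps flip: sum.distrib)
  then show ?thesis
    unfolding down up by (simp add: distrib_left sum.distrib add_ac)
qed

text \<open>By symmetry, steps move one at a time from the first factor to the second. In terms of
  paths: a closed path of length \<open>i + j\<close> is cut after \<open>i\<close> steps and its
  second part reversed.\<close>

lemma motzkin_sum_symmetric:
  assumes "Suc (i + j) < N"
  shows "(\<Sum>k<N. motzkin_sum b i k * motzkin_sum b j k) = motzkin_sum b (i + j) 0"
  using assms
proof (induction i arbitrary: j)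
  case 0
  have "(\<Sum>k<N. motzkin_sum b 0 k * motzkin_sum b j k) =
      (\<Sum>k<N. if k = 0 then motzkin_sum b j k else 0)"
    by (rule sum.cong) auto
  also have "\<dots> = motzkin_sum b j 0"
    using 0 by (simp add: sum.delta')
  finally show ?case by simp
next
  case (Suc i)
  have "(\<Sum>k<N. motzkin_sum b (Suc i) k * motzkin_sum b j k) =
      (\<Sum>k<N. motzkin_sum b i k * motzkin_sum b (Suc j) k)"
    using Suc.prems by (subst motzkin_sum_adjoint) auto
  also have "\<dots> = motzkin_sum b (i + Suc j) 0"
    using Suc.prems by (intro Suc.IH) simp
  finally show ?case by simp
qed

lemma motzkin_sum_truncate:
  assumes "i < n"
  shows "(\<Sum>k<n. motzkin_sum b i k * v k) = (\<Sum>k<n + N. motzkin_sum b i k * v k)"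
  using assms by (intro sum.mono_neutral_left) (auto simp: motzkin_sum_eq_0)

text \<open>The tridiagonal operator maps the alternating vector to the first unit vector. Hence
  this vector solves the linear system whose right-hand side is the first Hankel column.\<close>

lemma sum_motzkin_three_term:
  assumes "i < n"
  shows "(\<Sum>k<n. motzkin_sum b i k * ((- 1) ^ k * three_term b (Suc k))) =
    (if i = 0 then 1 else motzkin_sum b (i - 1) 0)"
proof (cases i)
  case 0
  have "(\<Sum>k<n. motzkin_sum b 0 k * ((- 1) ^ k * three_term b (Suc k))) =
      (\<Sum>k<n. if k = 0 then 1 else 0)"
    by (rule sum.cong) auto
  then show ?thesis
    using 0 assms by simp
next
  case (Suc i')
  \<comment> \<open>For \<open>k > 0\<close> this is the recurrence with alternating signs; at
    \<open>k = 0\<close> the missing neighbour leaves \<open>three_term b 0 = 1\<close>.\<close>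
  have kernel: "(if k = 0 then 0 else (- 1) ^ (k - 1) * three_term b (Suc (k - 1)))
      + b k * ((- 1) ^ k * three_term b (Suc k)) + (- 1) ^ Suc k * three_term b (Suc (Suc k))
      = (if k = 0 then 1 else 0)" for k
    by (cases k) (auto simp: algebra_simps)
  have "(\<Sum>k<n. motzkin_sum b (Suc i') k * ((- 1) ^ k * three_term b (Suc k))) =
      (\<Sum>k<n. motzkin_sum b i' k * (if k = 0 then 1 else 0))"
    using assms Suc
    by (subst motzkin_sum_adjoint) (auto simp: kernel simp del: three_term.simps power_Suc)
  also have "\<dots> = (\<Sum>k<n. if k = 0 then motzkin_sum b i' k else 0)"
    by (rule sum.cong) auto
  also have "\<dots> = motzkin_sum b i' 0"
    using assms by simp
  finally show ?thesis
    using Suc by simp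
qed

text \<open>Expansion along the last row, where only column 0 can be nonzero; deleting that row and
  column leaves the identity.\<close>

lemma det_shift_matrix:
  fixes v :: "nat \<Rightarrow> 'a :: comm_ring_1"
  shows "det (mat (Suc n) (Suc n) (\<lambda>(i, j). if j = 0 then v i else if Suc i = j then 1 else 0))
    = (- 1) ^ n * v n"
proof -
  define C where
    "C = mat (Suc n) (Suc n) (\<lambda>(i, j). if j = 0 then v i else if Suc i = j then 1 else 0)"
  have C: "C \<in> carrier_mat (Suc n) (Suc n)"
    by (simp add: C_def)
  have minor: "mat_delete C n 0 = 1\<^sub>m n"
    by (rule eq_matI) (auto simp: C_def mat_delete_def)
  have "det C = (\<Sum>j<Suc n. C $$ (n, j) * cofactor C n j)"
    by (rule laplace_expansion_row[OF C]) simp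
  also have "\<dots> = (\<Sum>j<Suc n. if j = 0 then v n * (- 1) ^ n else 0)"
    by (rule sum.cong) (auto simp: C_def[symmetric] cofactor_def minor, auto simp: C_def)
  finally show ?thesis
    by (simp add: C_def mult.commute)
qed

lemma index_mult_mat_sum:
  assumes "A \<in> carrier_mat n n" "B \<in> carrier_mat n n" "i < n" "j < n"
  shows "(A * B) $$ (i, j) = (\<Sum>k<n. A $$ (i, k) * B $$ (k, j))"
  using assms by (simp add: scalar_prod_def lessThan_atLeast0)

text \<open>The Hankel matrix factors as \<open>W C R\<close> with \<open>W\<close> lower and \<open>R\<close> upper unitriangular,
  because all columns but the first are inner products of rows of \<open>W\<close>.\<close>

lemma hankel_det_eq_three_term:
  fixes F :: "'a :: comm_ring_1 fps"
  assumes F0: "fps_nth F 0 = 1"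
    and FSuc: "\<And>n. fps_nth F (Suc n) = motzkin_sum b n 0"
  shows "hankel_det n F = three_term b n"
proof (cases n)
  case 0
  then show ?thesis
    by (simp add: hankel_det_def shifted_hankel_det_def)
next
  case (Suc n')
  define H where "H = mat n n (\<lambda>(i, j). fps_nth F (0 + i + j))"
  define W where "W = mat n n (\<lambda>(i, k). motzkin_sum b i k)"
  \<comment> \<open>\<open>C\<close> holds the solution for the first Hankel column and shifts the
    remaining columns by one. \<open>R\<close> is the transpose of a \<open>W\<close> of order
    \<open>n - 1\<close>, bordered by a leading 1.\<close>
  define C where "C = mat n n (\<lambda>(i, j). if j = 0 then (- 1) ^ i * three_term b (Suc i)
    else if Suc i = j then 1 else 0)"
  define R where "R = mat n n (\<lambda>(i, j). if i = 0 then if j = 0 then 1 else 0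
    else if j = 0 then 0 else motzkin_sum b (j - 1) (i - 1))"
  have carrier: "W \<in> carrier_mat n n" "C \<in> carrier_mat n n" "R \<in> carrier_mat n n"
    by (simp_all add: W_def C_def R_def)
  have CR: "(C * R) $$ (k, j) =
      (if j = 0 then (- 1) ^ k * three_term b (Suc k) else motzkin_sum b (j - 1) k)"
    if "k < n" "j < n" for k j
  proof -
    have "(C * R) $$ (k, j) = (\<Sum>i<n. C $$ (k, i) * R $$ (i, j))"
      using that carrier by (intro index_mult_mat_sum)
    also have "\<dots> = C $$ (k, 0) * R $$ (0, j) + (\<Sum>i<n'. C $$ (k, Suc i) * R $$ (Suc i, j))"
      unfolding Suc sum.lessThan_Suc_shift ..
    also have "(\<Sum>i<n'. C $$ (k, Suc i) * R $$ (Suc i, j)) =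
        (\<Sum>i<n'. if i = k then if j = 0 then 0 else motzkin_sum b (j - 1) k else 0)"
      using that Suc by (intro sum.cong) (auto simp: C_def R_def)
    \<comment> \<open>For \<open>k = n'\<close> no summand has \<open>i = k\<close>, which agrees
      with the right-hand side: for \<open>j > 0\<close> the sum
      \<open>motzkin_sum b (j - 1) k\<close> vanishes because \<open>j - 1 < k\<close>.\<close>
    also have "\<dots> = (if j = 0 then 0 else motzkin_sum b (j - 1) k)"
      using that Suc by (auto simp: motzkin_sum_eq_0)
    finally show ?thesis
      using that by (auto simp: C_def R_def)
  qed
  have "H = W * (C * R)"
  proof (rule eq_matI)
    fix i j
    assume "i < dim_row (W * (C * R))" "j < dim_col (W * (C * R))"
    then have ij: "i < n" "j < n"
      using carrier by auto
    have "(W * (C * R)) $$ (i, j) = (\<Sum>k<n. W $$ (i, k) * (C * R) $$ (k, j))"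
      using ij carrier by (intro index_mult_mat_sum mult_carrier_mat)
    also have "\<dots> = (\<Sum>k<n. motzkin_sum b i k *
        (if j = 0 then (- 1) ^ k * three_term b (Suc k) else motzkin_sum b (j - 1) k))"
      using ij by (intro sum.cong) (auto simp: CR W_def)
    also have "\<dots> = fps_nth F (i + j)"
    proof (cases j)
      case 0
      then show ?thesis
        using sum_motzkin_three_term[of i n b] ij F0 FSuc[of "i - 1"] by auto
    next
      case (Suc j')
      \<comment> \<open>Extending the range from \<open>n\<close> to \<open>n + n\<close> adds only
        zeros and meets the bound of \<open>motzkin_sum_symmetric\<close>.\<close>
      then show ?thesis
        using ij motzkin_sum_truncate[of i n b "motzkin_sum b j'" n]
        by (simp add: motzkin_sum_symmetric FSuc)
    qed
    finally show "H $$ (i, j) = (W * (C * R)) $$ (i, j)"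
      using ij by (simp add: H_def)
  qed (use carrier in \<open>auto simp: H_def\<close>)
  moreover have "det W = 1"
  proof -
    have "det W = prod_list (diag_mat W)"
      using carrier by (intro det_lower_triangular[of n]) (auto simp: W_def motzkin_sum_eq_0)
    then show ?thesis
      by (simp add: prod_list_diag_prod W_def motzkin_sum_diag)
  qed
  moreover have "det R = 1"
  proof -
    have "det R = prod_list (diag_mat R)"
      using carrier by (intro det_upper_triangular upper_triangularI)
        (auto simp: R_def motzkin_sum_eq_0)
    then show ?thesis
      by (auto simp: prod_list_diag_prod R_def motzkin_sum_diag intro: prod.neutral)
  qed
  moreover have "det C = three_term b n"
  proof -
    have "det C = (- 1) ^ n' * ((- 1) ^ n' * three_term b (Suc n'))"
      unfolding C_def Suc by (rule det_shift_matrix)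
    also have "\<dots> = three_term b n"
      by (simp add: Suc flip: mult.assoc power_mult_distrib)
    finally show ?thesis .
  qed
  ultimately have "det H = three_term b n"
    using carrier det_mult[of W n "C * R"] det_mult[of C n R] by simp
  then show ?thesis
    by (simp add: hankel_det_def shifted_hankel_det_def H_def)
qed

section \<open>Counting prefixes of Dyck paths\<close>

lemma height_append: "i \<le> length p \<Longrightarrow> height (p @ q) i = height p i"
  by (simp add: height_def)

lemma height_snoc: "height (p @ [x]) (Suc (length p)) = height p (length p) + rise x"
  by (simp add: height_def)

lemma peak_heights_short: "length p \<le> 1 \<Longrightarrow> peak_heights p = {}"
  by (auto simp: peak_heights_def)

text \<open>Only the two last steps can form a peak that was absent before.\<close>

lemma peak_heights_snoc2:
  "peak_heights (p @ [x, y]) = peak_heights (p @ [x]) \<union>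
     (if x = Up \<and> y = Down then {height (p @ [x]) (Suc (length p))} else {})"
proof -
  \<comment> \<open>Peaks are compared by position, since distinct peaks may share a height.\<close>
  define I where "I = (\<lambda>r. {i. Suc i < length r \<and> r ! i = Up \<and> r ! Suc i = Down})"
  have peaks: "peak_heights r = (\<lambda>i. height r (Suc i)) ` I r" for r
    unfolding peak_heights_def I_def by blast
  have "i \<in> I (p @ [x, y]) \<longleftrightarrow>
      i \<in> I (p @ [x]) \<union> (if x = Up \<and> y = Down then {length p} else {})" for i
  proof -
    consider "Suc i < length p" | "Suc i = length p" | "i = length p" | "i > length p"
      by linarith
    then show ?thesis
      by cases (simp_all add: I_def nth_append)
  qed
  then have "I (p @ [x, y]) = I (p @ [x]) \<union> (if x = Up \<and> y = Down then {length p} else {})"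
    by blast
  moreover have "height (p @ [x, y]) (Suc i) = height (p @ [x]) (Suc i)"
    if "i \<in> I (p @ [x]) \<or> i = length p" for i
    using that height_append[of "Suc i" "p @ [x]" "[y]"] by (auto simp: I_def)
  ultimately show ?thesis
    unfolding peaks by (auto simp: image_Un)
qed

text \<open>The end height is left free so that removing the last step stays inside the family; Dyck
  paths of size \<open>n\<close> are the case of length \<open>2 * n\<close> and end height
  0.\<close>

definition good_prefixes :: "int set \<Rightarrow> nat \<Rightarrow> int \<Rightarrow> step list set" where
  "good_prefixes A k h = {p. length p = k \<and> height p k = h \<and> (\<forall>i\<le>k. height p i \<ge> 0) \<and>
     peak_heights p \<inter> A = {}}"

lemma finite_good_prefixes: "finite (good_prefixes A k h)"
proof (rule finite_subset)
  have "x \<in> {Up, Down}" for x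
    by (cases x) auto
  then show "good_prefixes A k h \<subseteq> {p. set p \<subseteq> {Up, Down} \<and> length p = k}"
    by (auto simp: good_prefixes_def)
qed (simp add: finite_lists_length_eq)

lemma good_prefixes_negative: "h < 0 \<Longrightarrow> good_prefixes A k h = {}"
  by (auto simp: good_prefixes_def)

lemma good_prefixes_0: "good_prefixes A 0 h = (if h = 0 then {[]} else {})"
  by (auto simp: good_prefixes_def height_def peak_heights_short)

text \<open>A \<open>Down\<close> step ending at \<open>h\<close> starts at \<open>h + 1\<close>, so
  the peak it may complete has that height.\<close>

lemma snoc_in_good_prefixes:
  assumes "h \<ge> 0"
  shows "p @ [x] \<in> good_prefixes A (Suc k) h \<longleftrightarrow>
    p \<in> good_prefixes A k (h - rise x) \<and> (p \<noteq> [] \<and> last p = Up \<and> x = Down \<longrightarrow> h + 1 \<notin> A)"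
proof (cases p rule: rev_cases)
  case Nil
  then show ?thesis
    using assms
    by (auto simp: good_prefixes_def height_def peak_heights_short le_Suc_eq)
next
  case (snoc q y)
  have path: "(length (p @ [x]) = Suc k \<and> height (p @ [x]) (Suc k) = h \<and>
      (\<forall>i\<le>Suc k. height (p @ [x]) i \<ge> 0)) \<longleftrightarrow>
      (length p = k \<and> height p k = h - rise x \<and> (\<forall>i\<le>k. height p i \<ge> 0))"
    using assms height_snoc[of p x] by (auto simp: le_Suc_eq height_append)
  have peaks: "peak_heights (p @ [x]) \<inter> A = {} \<longleftrightarrow>
      peak_heights p \<inter> A = {} \<and> (p \<noteq> [] \<and> last p = Up \<and> x = Down \<longrightarrow> h + 1 \<notin> A)"
    if "length p = k \<and> height p k = h - rise x \<and> (\<forall>i\<le>k. height p i \<ge> 0)"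
    using that by (auto simp: snoc peak_heights_snoc2)
  have good: "q \<in> good_prefixes A k' h' \<longleftrightarrow>
      (length q = k' \<and> height q k' = h' \<and> (\<forall>i\<le>k'. height q i \<ge> 0)) \<and>
      peak_heights q \<inter> A = {}" for q k' h'
    by (simp only: good_prefixes_def mem_Collect_eq conj_assoc)
  show ?thesis
    unfolding good path using peaks by argo
qed

lemma card_good_prefixes_1: "card (good_prefixes A (Suc 0) h) = (if h = 1 then 1 else 0)"
proof (cases "h \<ge> 0")
  case True
  have "p \<in> good_prefixes A (Suc 0) h \<longleftrightarrow> h = 1 \<and> p = [Up]" for p
  proof (cases p rule: rev_cases)
    case Nil
    then show ?thesis
      by (auto simp: good_prefixes_def)
  next
    case (snoc q x)
    then show ?thesis
      using True by (cases x) (auto simp: snoc_in_good_prefixes good_prefixes_0)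
  qed
  then have "good_prefixes A (Suc 0) h = (if h = 1 then {[Up]} else {})"
    by auto
  then show ?thesis
    by simp
qed (simp add: good_prefixes_negative)

text \<open>Classification by the last step, minus the extensions by \<open>Up\<close>,
  \<open>Down\<close> that would create a forbidden peak at height \<open>h + 1\<close>.\<close>

lemma card_good_prefixes_Suc_Suc:
  assumes "h \<ge> 0"
  shows "int (card (good_prefixes A (Suc (Suc k)) h)) =
    int (card (good_prefixes A (Suc k) (h - 1))) + int (card (good_prefixes A (Suc k) (h + 1)))
    - (if h + 1 \<in> A then int (card (good_prefixes A k h)) else 0)"
proof -
  \<comment> \<open>The prefixes that must not be followed by \<open>Down\<close>. They correspond
    to good prefixes two steps shorter than the result, because a final \<open>Up\<close> completes
    no peak.\<close>
  define B where "B = (if h + 1 \<in> A then (\<lambda>p. p @ [Up]) ` good_prefixes A k h else {})"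
  have B: "B \<subseteq> good_prefixes A (Suc k) (h + 1)"
    using assms by (auto simp: B_def snoc_in_good_prefixes)
  have mem_B: "q \<in> B \<longleftrightarrow> h + 1 \<in> A \<and> last q = Up"
    if "q \<in> good_prefixes A (Suc k) (h + 1)" for q
  proof (cases q rule: rev_cases)
    case Nil
    then show ?thesis
      using that by (auto simp: good_prefixes_def)
  next
    case (snoc r y)
    then show ?thesis
      using that assms by (auto simp: B_def image_iff snoc_in_good_prefixes)
  qed
  have inj: "inj_on (\<lambda>p. p @ [x]) S" for x :: step and S
    by (auto simp: inj_on_def)
  have "p \<in> good_prefixes A (Suc (Suc k)) h \<longleftrightarrow>
      p \<in> (\<lambda>p. p @ [Up]) ` good_prefixes A (Suc k) (h - 1) \<union>
        (\<lambda>p. p @ [Down]) ` (good_prefixes A (Suc k) (h + 1) - B)" for p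
  proof (cases p rule: rev_cases)
    case Nil
    then show ?thesis
      by (auto simp: good_prefixes_def)
  next
    case (snoc q x)
    have "q \<noteq> []" if "q \<in> good_prefixes A (Suc k) h'" for h'
      using that by (auto simp: good_prefixes_def)
    then show ?thesis
      using assms mem_B[of q]
      by (cases x) (auto simp: snoc snoc_in_good_prefixes image_iff)
  qed
  then have "good_prefixes A (Suc (Suc k)) h =
      (\<lambda>p. p @ [Up]) ` good_prefixes A (Suc k) (h - 1) \<union>
        (\<lambda>p. p @ [Down]) ` (good_prefixes A (Suc k) (h + 1) - B)"
    by blast
  moreover have "card \<dots> = card (good_prefixes A (Suc k) (h - 1)) +
      card (good_prefixes A (Suc k) (h + 1) - B)"
    by (subst card_Un_disjoint) (auto simp: finite_good_prefixes card_image[OF inj])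
  moreover have "int (card (good_prefixes A (Suc k) (h + 1) - B)) =
      int (card (good_prefixes A (Suc k) (h + 1))) - int (card B)"
    using B finite_subset[OF B finite_good_prefixes] card_mono[OF finite_good_prefixes B]
    by (simp add: card_Diff_subset of_nat_diff)
  moreover have "card B = (if h + 1 \<in> A then card (good_prefixes A k h) else 0)"
    by (simp add: B_def card_image[OF inj])
  ultimately show ?thesis
    by simp
qed

text \<open>If no odd height is forbidden, sampling a path at odd times only records odd heights
  \<open>2 k + 1\<close>, and two consecutive steps change \<open>k\<close> by at most 1; a forbidden height
  \<open>2 k + 2\<close> removes one of the two ways to return to \<open>2 k + 1\<close>.\<close>

lemma card_good_prefixes_odd:
  assumes even_A: "\<And>h. h \<in> A \<Longrightarrow> even h"
  shows "int (card (good_prefixes A (Suc (2 * n)) (2 * int k + 1))) =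
    motzkin_sum (\<lambda>i. 2 - of_bool (2 * (int i + 1) \<in> A)) n k"
proof (induction n arbitrary: k)
  case 0
  then show ?case
    by (simp add: card_good_prefixes_1)
next
  case (Suc n)
  define c where "c = (\<lambda>k h. int (card (good_prefixes A k h)))"
  define N where "N = 2 * n"
  define b :: "nat \<Rightarrow> int" where "b = (\<lambda>i. 2 - of_bool (2 * (int i + 1) \<in> A))"
  \<comment> \<open>The peak at stake has odd height, so nothing is subtracted.\<close>
  have even_step: "c (Suc (Suc N)) (2 * i) = c (Suc N) (2 * i - 1) + c (Suc N) (2 * i + 1)"
    if "i \<ge> 0" for i
    using card_good_prefixes_Suc_Suc[of "2 * i" A N] that even_A[of "2 * i + 1"]
    by (auto simp: c_def)
  have IH: "c (Suc N) (2 * int i + 1) = motzkin_sum b n i" for i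
    using Suc.IH by (simp add: c_def N_def b_def)
  have "c (Suc (Suc (Suc N))) (2 * int k + 1) = c (Suc (Suc N)) (2 * int k) +
      c (Suc (Suc N)) (2 * (int k + 1)) - of_bool (2 * (int k + 1) \<in> A) * c (Suc N) (2 * int k + 1)"
    using card_good_prefixes_Suc_Suc[of "2 * int k + 1" A "Suc N"]
    by (auto simp: c_def algebra_simps)
  \<comment> \<open>Height \<open>2 * int k + 1\<close> is reached through either even neighbour,
    hence twice; the subtracted term turns this 2 into \<open>b k\<close>.\<close>
  also have "\<dots> = c (Suc N) (2 * int k - 1) + b k * c (Suc N) (2 * int k + 1)
      + c (Suc N) (2 * int (Suc k) + 1)"
    using even_step[of "int k"] even_step[of "int k + 1"] by (simp add: b_def algebra_simps)
  also have "c (Suc N) (2 * int k - 1) = (if k = 0 then 0 else motzkin_sum b n (k - 1))"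
  proof (cases k)
    case 0
    then show ?thesis
      by (simp add: c_def good_prefixes_negative)
  next
    case (Suc k')
    then show ?thesis
      using IH[of k'] by (simp add: algebra_simps)
  qed
  finally show ?case
    by (simp only: IH motzkin_sum.simps) (simp add: c_def N_def b_def)
qed

section \<open>From prefixes back to Dyck paths\<close>

lemma dyck_num_eq_card:
  "dyck_num m V n = card (good_prefixes (residue_heights m V) (2 * n) 0)"
  unfolding dyck_num_def dyck_path_def good_prefixes_def by (simp add: conj_ac)

text \<open>A nonempty Dyck path ends with \<open>Down\<close> from height 1. Removing that step
  gives an odd-length prefix at height 1, so the coefficients after the constant term are the
  moments.\<close>

lemma hankel_det_dyck_gf:
  assumes "\<And>h. h \<in> residue_heights m V \<Longrightarrow> even h"
  shows "hankel_det n (dyck_gf m V) =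
    three_term (\<lambda>i. 2 - of_bool (2 * (int i + 1) \<in> residue_heights m V)) n"
proof (rule hankel_det_eq_three_term)
  show "fps_nth (dyck_gf m V) 0 = 1"
    by (simp add: dyck_gf_def dyck_num_eq_card good_prefixes_0)
next
  fix n
  have "1 \<notin> residue_heights m V"
    using assms[of 1] by auto
  then have "int (dyck_num m V (Suc n)) =
      int (card (good_prefixes (residue_heights m V) (Suc (2 * n)) 1))"
    using card_good_prefixes_Suc_Suc[of 0 "residue_heights m V" "2 * n"]
    by (simp add: dyck_num_eq_card good_prefixes_negative)
  then show "fps_nth (dyck_gf m V) (Suc n) =
      motzkin_sum (\<lambda>i. 2 - of_bool (2 * (int i + 1) \<in> residue_heights m V)) n 0"
    using card_good_prefixes_odd[of "residue_heights m V" n 0] assms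
    by (simp add: dyck_gf_def)
qed

section \<open>Arithmetic sections\<close>

text \<open>In terms of the differences of \<open>h\<close> the recurrence says that the slope changes exactly at
  the points \<open>n\<close> of \<open>E\<close>, where it drops by \<open>h n\<close>.\<close>

lemma three_term_sections:
  fixes h :: "nat \<Rightarrow> int" and \<sigma> \<tau> :: "nat \<Rightarrow> nat"
  defines "d \<equiv> \<lambda>j. h (Suc (\<sigma> j)) - h (\<sigma> j)"
  assumes h: "h = three_term (\<lambda>i. 2 - of_bool (Suc i \<in> E))"
    and start: "1 \<le> \<sigma> 1" "\<And>n. 1 \<le> n \<Longrightarrow> n < \<sigma> 1 \<Longrightarrow> n \<notin> E"
    and step: "\<And>j. 1 \<le> j \<Longrightarrow> \<sigma> (Suc j) = \<sigma> j + \<tau> j" "\<And>j. 1 \<le> j \<Longrightarrow> 1 \<le> \<tau> j"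
    and break: "\<And>j. 1 \<le> j \<Longrightarrow> \<sigma> j \<in> E"
    and gap: "\<And>j n. 1 \<le> j \<Longrightarrow> \<sigma> j < n \<Longrightarrow> n < \<sigma> (Suc j) \<Longrightarrow> n \<notin> E"
  shows "n \<le> \<sigma> 1 \<Longrightarrow> h n = 1"
    and "1 \<le> j \<Longrightarrow> i < \<tau> j \<Longrightarrow> h (\<sigma> j + Suc i) = h (\<sigma> j + i) + d j"
    and "h (Suc (\<sigma> 1)) = 0" and "d 1 = - 1"
    and "1 \<le> j \<Longrightarrow> h (Suc (\<sigma> (Suc j))) = d j"
    and "1 \<le> j \<Longrightarrow> d (Suc j) = d j - h (\<sigma> j + \<tau> j)"
proof -
  define D where "D = (\<lambda>n. h (Suc n) - h n)"
  \<comment> \<open>The two equal initial values make the slope start at 0, which yields the opening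
    block of ones.\<close>
  have D_0: "D 0 = 0"
    by (simp add: D_def h)
  have D_Suc: "D (Suc n) = D n - of_bool (Suc n \<in> E) * h (Suc n)" for n
    by (simp add: D_def h algebra_simps)
  have D_const: "D n = D k" if "k \<le> n" "\<And>i. k < i \<Longrightarrow> i \<le> n \<Longrightarrow> i \<notin> E" for k n
    using that by (induction rule: dec_induct) (auto simp: D_Suc)
  have D_start: "D n = 0" if "n < \<sigma> 1" for n
    using D_const[of 0 n] D_0 start(2) that by auto
  have h_start: "h n = 1" if "n \<le> \<sigma> 1" for n
    using that
  proof (induction n)
    case 0
    then show ?case by (simp add: h)
  next
    case (Suc n)
    then show ?case
      using D_start[of n] by (simp add: D_def)
  qed
  then show "n \<le> \<sigma> 1 \<Longrightarrow> h n = 1" .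
  have D_sigma: "D (\<sigma> j) = D (\<sigma> j - 1) - h (\<sigma> j)" if "1 \<le> j" "1 \<le> \<sigma> j" for j
    using D_Suc[of "\<sigma> j - 1"] that break[of j] by simp
  \<comment> \<open>The index \<open>i = 0\<close> covers the jump from the last entry before
    section \<open>j\<close> to its first entry.\<close>
  have D_section: "D (\<sigma> j + i) = d j" if "1 \<le> j" "i < \<tau> j" for i j
    using D_const[of "\<sigma> j" "\<sigma> j + i"] gap[of j] that step(1)[of j] by (auto simp: d_def D_def)
  show "1 \<le> j \<Longrightarrow> i < \<tau> j \<Longrightarrow> h (\<sigma> j + Suc i) = h (\<sigma> j + i) + d j"
    using D_section[of j i] by (simp add: D_def)
  show d1: "d 1 = - 1"
    using D_sigma[of 1] D_start[of "\<sigma> 1 - 1"] h_start[of "\<sigma> 1"] start(1)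
    by (simp add: d_def D_def)
  then show "h (Suc (\<sigma> 1)) = 0"
    using h_start[of "\<sigma> 1"] by (simp add: d_def)
  have D_next: "D (\<sigma> (Suc j)) = d j - h (\<sigma> (Suc j))" if "1 \<le> j" for j
  proof -
    \<comment> \<open>The slope arriving at the next break point is still that of section
      \<open>j\<close>; this uses that sections are nonempty.\<close>
    have "\<sigma> (Suc j) - 1 = \<sigma> j + (\<tau> j - 1)" "1 \<le> \<sigma> (Suc j)"
      using step[OF that] by auto
    then show ?thesis
      using D_sigma[of "Suc j"] D_section[of j "\<tau> j - 1"] step(2)[OF that] that by simp
  qed
  \<comment> \<open>The slope drops by exactly the current value, so adding the new slope cancels
    that value.\<close>
  show "1 \<le> j \<Longrightarrow> h (Suc (\<sigma> (Suc j))) = d j"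
    using D_next[of j] by (simp add: D_def)
  show "1 \<le> j \<Longrightarrow> d (Suc j) = d j - h (\<sigma> j + \<tau> j)"
    using D_next[of j] step(1)[of j] by (simp add: D_def d_def)
qed

section \<open>Forbidden heights as residue classes modulo half the period\<close>

lemma even_residue_heights_iff:
  assumes "1 \<le> n"
  shows "2 * int n \<in> residue_heights (2 * M) ((\<lambda>j. 2 * s j) ` J) \<longleftrightarrow>
    (\<exists>j\<in>J. [n = s j] (mod M))"
proof -
  have "[2 * int n = int (2 * k)] (mod int (2 * M)) \<longleftrightarrow> [n = k] (mod M)" for k
    using cong_int_iff[of "2 * n" "2 * k" "2 * M"] by (simp add: cong_def)
  then show ?thesis
    using assms unfolding residue_heights_def by simp
qed

lemma residue_heights_even:
  assumes "h \<in> residue_heights (2 * M) ((\<lambda>j. 2 * s j) ` J)"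
  shows "even h"
proof -
  from assms obtain j where "[h = int (2 * s j)] (mod int (2 * M))"
    by (auto simp: residue_heights_def)
  then have "[h = int (2 * s j)] (mod 2)"
    by (rule cong_dvd_modulus) simp
  then show ?thesis
    by (simp add: cong_def even_iff_mod_2_eq_zero)
qed

lemma not_cong_near:
  fixes x y M :: nat
  assumes "x < y" "y < x + M"
  shows "\<not> [x = y] (mod M)" "\<not> [y = x] (mod M)"
proof -
  show "\<not> [y = x] (mod M)"
  proof
    assume "[y = x] (mod M)"
    then have "M dvd y - x"
      using assms(1) by (simp add: cong_altdef_nat)
    then show False
      using assms by (auto dest!: dvd_imp_le)
  qed
  then show "\<not> [x = y] (mod M)"
    by (simp add: cong_sym_eq)
qed

text \<open>Two members of the range differ by less than \<open>l\<close>. This determines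
  \<open>bar\<close> from its congruence.\<close>

lemma cong_residue_unique:
  fixes x y l :: nat
  assumes "x \<in> {1..l}" "y \<in> {1..l}" "[x = y] (mod l)"
  shows "x = y"
  using assms not_cong_near[of x y l] not_cong_near[of y x l] by (cases x y rule: linorder_cases) auto

theorem theorem1p1:
  fixes m l :: nat and V :: "nat set" and s t bar :: "nat \<Rightarrow> nat"
  assumes "m \<ge> 2" and "even m" and "l \<ge> 1"
    and "\<forall>j\<in>{1..l}. 1 \<le> s j \<and> s j \<le> m div 2"
    and "strict_mono_on {1..l} s"
    and "V = (\<lambda>j. 2 * s j) ` {1..l}"
    and "\<forall>j\<in>{1..<l}. t j = s (j + 1) - s j"
    and "t l = m div 2 - s l + s 1"
    and "\<forall>j\<ge>1. bar j \<in> {1..l} \<and> [bar j = j] (mod l)"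
  shows "\<exists>(a :: nat \<Rightarrow> nat \<Rightarrow> int) (d :: nat \<Rightarrow> int).
      (\<forall>n\<in>{1..s 1}. hankel_det n (dyck_gf m V) = 1) \<and>
      (\<forall>j\<ge>1. \<forall>i\<in>{1..t (bar j)}.
         hankel_det (s 1 + (\<Sum>k\<in>{1..<j}. t (bar k)) + i) (dyck_gf m V) = a j i) \<and>
      (\<forall>j\<ge>1. \<forall>i\<in>{1..<t (bar j)}. a j (i + 1) = a j i + d j) \<and>
      a 1 1 = 0 \<and> d 1 = - 1 \<and>
      (\<forall>j\<ge>2. a j 1 = d (j - 1) \<and> d j = d (j - 1) - a (j - 1) (t (bar (j - 1))))"
proof -
  define M where "M = m div 2"
  \<comment> \<open>The indices \<open>n\<close> for which height \<open>2 * n\<close> is forbidden,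
    with the common factor 2 cancelled.\<close>
  define E where "E = {n. \<exists>j\<in>{1..l}. [n = s j] (mod M)}"
  define h where "h = (\<lambda>n. hankel_det n (dyck_gf m V))"
  \<comment> \<open>The index of the last entry before section \<open>j\<close>; the empty sum gives
    \<open>s 1\<close> for \<open>j = 1\<close>.\<close>
  define \<sigma> where "\<sigma> = (\<lambda>j. s 1 + (\<Sum>k\<in>{1..<j}. t (bar k)))"
  define \<tau> where "\<tau> = (\<lambda>j. t (bar j))"
  have m: "m = 2 * M"
    using \<open>even m\<close> by (simp add: M_def)
  have s_bounds: "1 \<le> s c" "s c \<le> M" if "c \<in> {1..l}" for c
    using that assms(4) by (auto simp: M_def)
  have s_less: "s c < s c'" if "1 \<le> c" "c < c'" "c' \<le> l" for c c'
    using strict_mono_onD[OF assms(5)] that by auto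
  have s_le: "s c \<le> s c'" if "1 \<le> c" "c \<le> c'" "c' \<le> l" for c c'
    using s_less[of c c'] that by (cases "c = c'") auto
  have bar: "bar j \<in> {1..l}" "[bar j = j] (mod l)" if "1 \<le> j" for j
    using assms(9) that by auto
  have bar_1: "bar 1 = 1"
    using bar[of 1] \<open>l \<ge> 1\<close> by (intro cong_residue_unique[of _ l]) auto
  have bar_Suc: "bar (Suc j) = (if bar j < l then Suc (bar j) else 1)" if "1 \<le> j" for j
  proof (rule cong_residue_unique)
    have "[bar (Suc j) = Suc (bar j)] (mod l)"
      using bar(2)[of "Suc j"] bar(2)[OF that] cong_add[of j "bar j" l 1 1]
      by (auto intro: cong_trans simp: cong_sym_eq)
    moreover have "[Suc l = 1] (mod l)"
      by (simp add: cong_altdef_nat)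
    ultimately show "[bar (Suc j) = (if bar j < l then Suc (bar j) else 1)] (mod l)"
      using bar(1)[OF that] by (cases "bar j = l") (auto intro: cong_trans)
  qed (use bar(1)[of "Suc j"] bar(1)[OF that] in auto)
  have \<sigma>_1: "\<sigma> 1 = s 1"
    by (simp add: \<sigma>_def)
  have \<sigma>_Suc: "\<sigma> (Suc j) = \<sigma> j + \<tau> j" if "1 \<le> j" for j
    using that by (simp add: \<sigma>_def \<tau>_def)
  have \<tau>_less: "\<tau> j = s (Suc (bar j)) - s (bar j)" "s (bar j) < s (Suc (bar j))"
    if "1 \<le> j" "bar j < l" for j
    using assms(7) bar(1)[OF that(1)] that(2) s_less[of "bar j" "Suc (bar j)"]
    by (auto simp: \<tau>_def)
  have \<tau>_last: "\<tau> j = M - s l + s 1" if "bar j = l" for j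
    using assms(8) that by (simp add: \<tau>_def M_def)
  have \<tau>_pos: "1 \<le> \<tau> j" if "1 \<le> j" for j
    using \<tau>_less[OF that] \<tau>_last[of j] bar(1)[OF that] s_bounds[of 1] \<open>l \<ge> 1\<close>
    by (cases "bar j < l") auto
  \<comment> \<open>One cycle of \<open>bar\<close> advances \<sigma> by \<open>M\<close>: the
    wrap-around length \<open>M - s l + s 1\<close> leads from \<open>q * M + s l\<close> to
    \<open>Suc q * M + s 1\<close>.\<close>
  have \<sigma>_periodic: "\<exists>q. \<sigma> j = q * M + s (bar j)" if "1 \<le> j" for j
    using that
  proof (induction j rule: nat_induct_at_least)
    case base
    show ?case
      using \<sigma>_1 bar_1 by (intro exI[of _ 0]) simp
  next
    case (Suc j)
    then obtain q where q: "\<sigma> j = q * M + s (bar j)"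
      by blast
    show ?case
    proof (cases "bar j < l")
      case True
      then have "\<sigma> (Suc j) = q * M + s (bar (Suc j))"
        using q \<sigma>_Suc[OF Suc.hyps] \<tau>_less[OF Suc.hyps True] bar_Suc[OF Suc.hyps] by simp
      then show ?thesis ..
    next
      case False
      then have "bar j = l"
        using bar(1)[OF Suc.hyps] by simp
      then have "\<sigma> (Suc j) = Suc q * M + s (bar (Suc j))"
        using q \<sigma>_Suc[OF Suc.hyps] \<tau>_last[of j] bar_Suc[OF Suc.hyps] s_bounds[of l] \<open>l \<ge> 1\<close>
        by simp
      then show ?thesis ..
    qed
  qed
  have break: "\<sigma> j \<in> E" if j: "1 \<le> j" for j
  proof -
    obtain q where "\<sigma> j = q * M + s (bar j)"
      using \<sigma>_periodic[OF j] by blast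
    then have "[\<sigma> j = s (bar j)] (mod M)"
      by (simp add: cong_def)
    then show ?thesis
      using bar(1)[OF j] by (auto simp: E_def)
  qed
  have start: "n \<notin> E" if n: "1 \<le> n" "n < \<sigma> 1" for n
  proof -
    have "\<not> [n = s c] (mod M)" if c: "c \<in> {1..l}" for c
      using n[unfolded \<sigma>_1] c s_bounds[OF c] s_le[of 1 c] by (intro not_cong_near) auto
    then show ?thesis
      by (simp add: E_def)
  qed
  have gap: "n \<notin> E" if j: "1 \<le> j" and n: "\<sigma> j < n" "n < \<sigma> (Suc j)" for j n
  proof -
    obtain q where q: "\<sigma> j = q * M + s (bar j)"
      using \<sigma>_periodic[OF j] by blast
    \<comment> \<open>After removal of full periods, every \<open>s c\<close> lies on one side of
      \<open>r\<close> at distance less than \<open>M\<close>: below it if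
      \<open>c \<le> bar j\<close>, above it otherwise.\<close>
    define r where "r = n - q * M"
    have n_eq: "n = q * M + r" and r: "s (bar j) < r" "r < s (bar j) + \<tau> j"
      using n q \<sigma>_Suc[OF j] by (auto simp: r_def)
    have "\<not> [r = s c] (mod M)" if c: "c \<in> {1..l}" for c
    proof (cases "c \<le> bar j")
      case True
      have "s c < r"
        using s_le[of c "bar j"] True c bar(1)[OF j] r by auto
      moreover have "r < s c + M"
      proof (cases "bar j < l")
        case True
        then have "r < s (Suc (bar j))" "s (Suc (bar j)) \<le> M"
          using r \<tau>_less[OF j True] s_bounds[of "Suc (bar j)"] by auto
        then show ?thesis by simp
      next
        case False
        then have "bar j = l"
          using bar(1)[OF j] by simp
        then have "r < M + s 1"
          using r \<tau>_last[of j] s_bounds[of l] \<open>l \<ge> 1\<close> by simp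
        then show ?thesis
          using s_le[of 1 c] c by simp
      qed
      ultimately show ?thesis
        by (rule not_cong_near)
    next
      case False
      then have "bar j < l" and "s (Suc (bar j)) \<le> s c"
        using c s_le[of "Suc (bar j)" c] by auto
      then have "r < s c"
        using r \<tau>_less[OF j] by simp
      then show ?thesis
        using s_bounds[OF c] r by (intro not_cong_near) auto
    qed
    moreover have "[n = r] (mod M)"
      by (simp add: n_eq cong_def)
    ultimately show ?thesis
      unfolding E_def by (auto dest: cong_trans[OF cong_sym])
  qed
  have "h = three_term (\<lambda>i. 2 - of_bool (Suc i \<in> E))"
  proof
    fix n
    have V: "residue_heights m V = residue_heights (2 * M) ((\<lambda>j. 2 * s j) ` {1..l})"
      by (simp only: m assms(6))
    have "2 * (int i + 1) \<in> residue_heights m V \<longleftrightarrow> Suc i \<in> E" for i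
      using even_residue_heights_iff[of "Suc i" M s "{1..l}"] unfolding V E_def
      by (simp add: add.commute)
    moreover have "even x" if "x \<in> residue_heights m V" for x
      using that residue_heights_even unfolding V by blast
    ultimately show "h n = three_term (\<lambda>i. 2 - of_bool (Suc i \<in> E)) n"
      unfolding h_def by (subst hankel_det_dyck_gf) auto
  qed
  moreover have "1 \<le> \<sigma> 1"
    unfolding \<sigma>_1 using s_bounds[of 1] \<open>l \<ge> 1\<close> by simp
  ultimately have sections:
    "\<And>n. n \<le> \<sigma> 1 \<Longrightarrow> h n = 1"
    "\<And>j i. 1 \<le> j \<Longrightarrow> i < \<tau> j \<Longrightarrow> h (\<sigma> j + Suc i) = h (\<sigma> j + i) + (h (Suc (\<sigma> j)) - h (\<sigma> j))"
    "h (Suc (\<sigma> 1)) = 0" "h (Suc (\<sigma> 1)) - h (\<sigma> 1) = - 1"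
    "\<And>j. 1 \<le> j \<Longrightarrow> h (Suc (\<sigma> (Suc j))) = h (Suc (\<sigma> j)) - h (\<sigma> j)"
    "\<And>j. 1 \<le> j \<Longrightarrow> h (Suc (\<sigma> (Suc j))) - h (\<sigma> (Suc j)) =
      h (Suc (\<sigma> j)) - h (\<sigma> j) - h (\<sigma> j + \<tau> j)"
    using three_term_sections[where h = h and \<sigma> = \<sigma> and \<tau> = \<tau> and E = E]
      start \<sigma>_Suc \<tau>_pos break gap by blast+
  \<comment> \<open>The witnesses, fixed by unification, are
    \<open>a j i = h (\<sigma> j + i)\<close> and
    \<open>d j = h (Suc (\<sigma> j)) - h (\<sigma> j)\<close>. Measuring \<open>d j\<close> from
    the entry before the section gives it a value even when the section has length 1.\<close>
  show ?thesis
  proof (intro exI conjI ballI allI impI)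
    show "hankel_det n (dyck_gf m V) = 1" if "n \<in> {1..s 1}" for n
      using sections(1)[of n, unfolded \<sigma>_1 h_def] that by simp
    show "hankel_det (s 1 + (\<Sum>k\<in>{1..<j}. t (bar k)) + i) (dyck_gf m V) = h (\<sigma> j + i)" for i j
      by (simp add: h_def \<sigma>_def)
    show "h (\<sigma> j + (i + 1)) = h (\<sigma> j + i) + (h (Suc (\<sigma> j)) - h (\<sigma> j))"
      if "1 \<le> j" "i \<in> {1..<t (bar j)}" for i j
      using sections(2)[of j i] that by (simp add: \<tau>_def)
    show "h (\<sigma> 1 + 1) = 0" "h (Suc (\<sigma> 1)) - h (\<sigma> 1) = - 1"
      using sections(3,4) by simp_all
    fix j :: nat
    assume "2 \<le> j"
    then obtain j' where j: "j = Suc j'" "1 \<le> j'"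
      by (cases j) auto
    show "h (\<sigma> j + 1) = h (Suc (\<sigma> (j - 1))) - h (\<sigma> (j - 1))"
      using sections(5)[OF j(2)] by (simp add: j(1))
    show "h (Suc (\<sigma> j)) - h (\<sigma> j) =
        h (Suc (\<sigma> (j - 1))) - h (\<sigma> (j - 1)) - h (\<sigma> (j - 1) + t (bar (j - 1)))"
      using sections(6)[OF j(2)] by (simp add: j(1) \<tau>_def)
  qed
qed

end
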